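(* There exists an absolute constant $C>0$ such that the following holds. Let $n,d\ge 1$ be integers, let $R>0$, and let $q,k_1,\dots,k_n\in\mathbb{R}^d$ be (deterministic) row vectors whose $\ell_2$-norms are all at most $R$. Let $\varepsilon>0$ and $\delta\in(0,1)$, and let the feature map dimension be $m=\left\lceil C\,\frac{n\exp(4R^2)}{\varepsilon^2\delta}\right\rceil$. Let $$A=\left(\frac{\exp(qk_j^{\top})}{\sum_{j'=1}^n\exp(qk_{j'}^{\top})}\right)_{j=1}^n,\qquad \hat A=\left(\frac{\phi(q)\phi(k_j)^{\top}}{\sum_{j'=1}^n\phi(q)\phi(k_{j'})^{\top}}\right)_{j=1}^n$$ be respectively the softmax attention scores and their approximation by the Positive Random Feature map $\phi=\phi_{PRF}:\mathbb{R}^d\to\mathbb{R}^m$. Then $$\Pr\left(\|A-\hat A\|_1\ge\varepsilon\right)\le\delta .$$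
   Context: The Positive Random Feature (PRF) map with feature map dimension $m$ is the random map $\phi_{PRF}:\mathbb{R}^d\to\mathbb{R}^m$, $$\phi_{PRF}(x)=\frac{\exp(-\|x\|^2/2)}{\sqrt m}\left[\exp(w_1x^{\top}),\dots,\exp(w_mx^{\top})\right],$$ where $w_1,\dots,w_m$ are independent random row vectors, each distributed as the standard Gaussian $N(0,I_d)$ on $\mathbb{R}^d$, and $\|\cdot\|$ is the Euclidean norm. The same sample $w_1,\dots,w_m$ is used for the query $q$ and all keys $k_1,\dots,k_n$. The probability is over $w_1,\dots,w_m$, and $\|\cdot\|_1$ is the $\ell_1$-norm on $\mathbb{R}^n$. *)

theory Defs
  imports "HOL-Probability.Probability"
begin

text \<open>
  A vector of \<open>\<real>\<^sup>d\<close> is a function \<open>nat \<Rightarrow> real\<close> of which only the coordinates below \<open>d\<close> are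
  ever used. The dimension is a natural number and not a type so that an absolute constant can be
  quantified before it; likewise for the indices of the keys and of the random features.
  The Euclidean norm on \<open>\<real>\<^sup>d\<close> is the library's \<open>L2_set x {..<d}\<close>.
\<close>

definition dot :: "nat \<Rightarrow> (nat \<Rightarrow> real) \<Rightarrow> (nat \<Rightarrow> real) \<Rightarrow> real" where
  "dot d x y = (\<Sum>i<d. x i * y i)"

definition l1_norm :: "nat \<Rightarrow> (nat \<Rightarrow> real) \<Rightarrow> real" where
  "l1_norm n x = (\<Sum>j<n. \<bar>x j\<bar>)"

text \<open>
  \<open>N(0, I\<^sub>d)\<close> as the product of \<open>d\<close> one-dimensional standard normal laws.
\<close>

definition std_gaussian :: "nat \<Rightarrow> (nat \<Rightarrow> real) measure" where
  "std_gaussian d = Pi\<^sub>M {..<d} (\<lambda>_. density lborel (\<lambda>t. ennreal (std_normal_density t)))"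

text \<open>
  The joint law of \<open>m\<close> independent \<open>N(0, I\<^sub>d)\<close> vectors; a sample \<open>w\<close> has rows \<open>w 0, \<dots>, w (m - 1)\<close>.
  Taking the canonical space, rather than an arbitrary one over a type variable, keeps constants
  from depending on the type of the sample space.
\<close>

definition gaussian_rows :: "nat \<Rightarrow> nat \<Rightarrow> (nat \<Rightarrow> nat \<Rightarrow> real) measure" where
  "gaussian_rows m d = Pi\<^sub>M {..<m} (\<lambda>_. std_gaussian d)"

definition prf_map ::
  "nat \<Rightarrow> nat \<Rightarrow> (nat \<Rightarrow> nat \<Rightarrow> real) \<Rightarrow> (nat \<Rightarrow> real) \<Rightarrow> (nat \<Rightarrow> real)" where
  "prf_map m d w x = (\<lambda>i. exp (- (L2_set x {..<d})\<^sup>2 / 2) / sqrt (real m) * exp (dot d (w i) x))"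

definition softmax_attention ::
  "nat \<Rightarrow> nat \<Rightarrow> (nat \<Rightarrow> real) \<Rightarrow> (nat \<Rightarrow> nat \<Rightarrow> real) \<Rightarrow> nat \<Rightarrow> real" where
  "softmax_attention n d q k j = exp (dot d q (k j)) / (\<Sum>j'<n. exp (dot d q (k j')))"

definition feature_attention ::
  "nat \<Rightarrow> nat \<Rightarrow> ((nat \<Rightarrow> real) \<Rightarrow> (nat \<Rightarrow> real)) \<Rightarrow>
    (nat \<Rightarrow> real) \<Rightarrow> (nat \<Rightarrow> nat \<Rightarrow> real) \<Rightarrow> nat \<Rightarrow> real" where
  "feature_attention n m \<phi> q k j =
    dot m (\<phi> q) (\<phi> (k j)) / (\<Sum>j'<n. dot m (\<phi> q) (\<phi> (k j')))"

end

theory Submission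
  imports Defs
begin

text \<open>
  Writing \<open>y = q + k\<^sub>j\<close>, the approximate kernel \<open>\<phi>(q)\<phi>(k\<^sub>j)\<^sup>T\<close> equals \<open>exp(q k\<^sub>j\<^sup>T)\<close> times the empirical
  mean of the i.i.d. variables \<open>exp(w\<^sub>i y\<^sup>T - \<parallel>y\<parallel>\<^sup>2/2)\<close>, which have mean \<open>1\<close> and second moment
  \<open>exp \<parallel>y\<parallel>\<^sup>2 \<le> exp(4R\<^sup>2)\<close>. Thus each kernel value is estimated with relative variance at most
  \<open>exp(4R\<^sup>2)/m\<close>. Normalising costs a factor \<open>2\<close> in the \<open>\<ell>\<^sub>1\<close> error, which is at most twice the
  \<open>A\<close>-weighted average of the relative errors; by convexity its square is at most four times the
  \<open>A\<close>-weighted average of their squares, and Markov's inequality concludes with \<open>C = 4\<close>.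
\<close>

section \<open>Exponential moments of the Gaussian\<close>

text \<open>Completing the square: multiplying the standard normal density by
  \<open>exp (t * a)\<close> gives \<open>exp (a\<^sup>2 / 2)\<close> times the density of mean
  \<open>a\<close> and variance 1, whose total mass is 1.\<close>

lemma has_bochner_integral_exp_std_normal:
  "has_bochner_integral (density lborel (\<lambda>t. ennreal (std_normal_density t)))
     (\<lambda>t. exp (t * a)) (exp (a\<^sup>2 / 2))"
proof -
  have "has_bochner_integral lborel (normal_density a 1) 1"
    by (simp add: has_bochner_integral_iff)
  then have "has_bochner_integral lborel (\<lambda>t. exp (a\<^sup>2 / 2) * normal_density a 1 t) (exp (a\<^sup>2 / 2) * 1)"
    by (intro has_bochner_integral_mult_right) auto
  moreover have "exp (a\<^sup>2 / 2) * normal_density a 1 t = std_normal_density t *\<^sub>R exp (t * a)" for t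
    by (simp add: normal_density_def mult_exp_exp power2_diff) (simp add: field_simps)
  ultimately show ?thesis
    by (intro has_bochner_integral_density) auto
qed

lemma prob_space_std_gaussian: "prob_space (std_gaussian d)"
  unfolding std_gaussian_def by (intro prob_space_PiM prob_space_normal_density) auto

lemma prob_space_gaussian_rows: "prob_space (gaussian_rows m d)"
  unfolding gaussian_rows_def by (intro prob_space_PiM prob_space_std_gaussian)

text \<open>The exponential of the inner product factors over the coordinates, so the product
  measure reduces the claim to the one-dimensional moment.\<close>

lemma has_bochner_integral_exp_std_gaussian:
  "has_bochner_integral (std_gaussian d) (\<lambda>w. exp (dot d w y)) (exp (dot d y y / 2))"
proof -
  let ?N = "density lborel (\<lambda>t. ennreal (std_normal_density t))"
  interpret prob_space ?N
    by (rule prob_space_normal_density) simp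
  interpret product_sigma_finite "\<lambda>_::nat. ?N"
    by unfold_locales
  have 1: "exp (dot d w y) = (\<Prod>i<d. exp (w i * y i))" for w
    by (simp add: dot_def exp_sum)
  have 2: "exp (dot d y y / 2) = (\<Prod>i<d. exp ((y i)\<^sup>2 / 2))"
    by (simp add: dot_def exp_sum sum_divide_distrib power2_eq_square)
  have int: "integrable ?N (\<lambda>t. exp (t * a))" for a
    using has_bochner_integral_exp_std_normal[of a] by (simp add: has_bochner_integral_iff)
  then show ?thesis
    unfolding has_bochner_integral_iff std_gaussian_def 1 2
    using product_integrable_prod[of "{..<d}" "\<lambda>i t. exp (t * y i)"]
      product_integral_prod[of "{..<d}" "\<lambda>i t. exp (t * y i)"]
    by (simp add: has_bochner_integral_integral_eq[OF has_bochner_integral_exp_std_normal])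
qed

text \<open>This is the likelihood ratio of the Gaussian with mean \<open>y\<close> and identity
  covariance against the standard one, whence its mean 1.\<close>

definition gaussian_tilt :: "nat \<Rightarrow> (nat \<Rightarrow> real) \<Rightarrow> (nat \<Rightarrow> real) \<Rightarrow> real" where
  "gaussian_tilt d y w = exp (dot d w y - dot d y y / 2)"

lemma has_bochner_integral_gaussian_tilt:
  "has_bochner_integral (std_gaussian d) (gaussian_tilt d y) 1"
proof -
  have "has_bochner_integral (std_gaussian d)
      (\<lambda>w. exp (- dot d y y / 2) * exp (dot d w y)) (exp (- dot d y y / 2) * exp (dot d y y / 2))"
    by (intro has_bochner_integral_mult_right has_bochner_integral_exp_std_gaussian)
  then show ?thesis
    by (simp add: mult_exp_exp gaussian_tilt_def[abs_def])
qed

text \<open>Squaring doubles the exponent, so the exponential moment is taken at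
  \<open>2 * y\<close>: it contributes \<open>exp (2 * dot d y y)\<close>, against the prefactor
  \<open>exp (- dot d y y)\<close>.\<close>

lemma has_bochner_integral_gaussian_tilt_squared:
  "has_bochner_integral (std_gaussian d) (\<lambda>w. (gaussian_tilt d y w)\<^sup>2) (exp (dot d y y))"
proof -
  define z where "z = (\<lambda>i. 2 * y i)"
  have z: "dot d w z = 2 * dot d w y" "dot d z y = 2 * dot d y y" for w
    by (simp_all add: dot_def z_def sum_distrib_left algebra_simps)
  have "has_bochner_integral (std_gaussian d)
      (\<lambda>w. exp (- dot d y y) * exp (dot d w z)) (exp (- dot d y y) * exp (dot d z z / 2))"
    by (intro has_bochner_integral_mult_right has_bochner_integral_exp_std_gaussian)
  then show ?thesis
    by (simp add: mult_exp_exp gaussian_tilt_def z flip: exp_double)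
qed

section \<open>Variance of an empirical mean\<close>

text \<open>Expand the square into a double sum. Independence and centering kill the off-diagonal
  terms, and each diagonal term contributes \<open>v\<close>.\<close>

lemma has_bochner_integral_sum_squared_PiM:
  fixes g :: "'a \<Rightarrow> real"
  assumes M: "prob_space M" and I: "finite I"
    and g: "has_bochner_integral M g 0" and g2: "has_bochner_integral M (\<lambda>x. (g x)\<^sup>2) v"
  shows "has_bochner_integral (Pi\<^sub>M I (\<lambda>_. M)) (\<lambda>w. (\<Sum>i\<in>I. g (w i))\<^sup>2) (real (card I) * v)"
proof -
  interpret prob_space M by fact
  interpret product_sigma_finite "\<lambda>_. M" by unfold_locales
  have cross: "has_bochner_integral (Pi\<^sub>M I (\<lambda>_. M)) (\<lambda>w. g (w i) * g (w j)) (if i = j then v else 0)"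
    if ij: "i \<in> I" "j \<in> I" for i j
  proof -
    \<comment> \<open>Writing \<open>g (w i) * g (w j)\<close> as a product over all of
      \<open>I\<close>, with one factor per coordinate, lets Fubini for finite products treat both
      cases at once: the factor is the square of \<open>g\<close> at \<open>l = i = j\<close> and
      the constant 1 away from \<open>i\<close> and \<open>j\<close>.\<close>
    define h where "h l x = (if l = i then g x else 1) * (if l = j then g x else 1)" for l x
    have h: "has_bochner_integral M (h l)
        (if l = i \<and> l = j then v else if l = i \<or> l = j then 0 else 1)" for l
      using g g2 prob_space by (auto simp: h_def[abs_def] power2_eq_square has_bochner_integral_iff)
    have prod: "(\<Prod>l\<in>I. h l (w l)) = g (w i) * g (w j)" for w
      using ij I by (simp add: h_def prod.distrib)
    have int: "(\<Prod>l\<in>I. integral\<^sup>L M (h l)) = (if i = j then v else 0)"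
    proof (cases "i = j")
      case True
      then have "(\<Prod>l\<in>I. integral\<^sup>L M (h l)) = (\<Prod>l\<in>I. if l = i then v else 1)"
        by (intro prod.cong) (auto simp: has_bochner_integral_integral_eq[OF h])
      then show ?thesis
        using True ij I by simp
    next
      case False
      then have "integral\<^sup>L M (h i) = 0"
        by (simp add: has_bochner_integral_integral_eq[OF h])
      then show ?thesis
        using False ij I by (auto intro!: prod_zero)
    qed
    have "integrable M (h l)" for l
      using h by (auto simp: has_bochner_integral_iff)
    then have "has_bochner_integral (Pi\<^sub>M I (\<lambda>_. M)) (\<lambda>w. \<Prod>l\<in>I. h l (w l)) (\<Prod>l\<in>I. integral\<^sup>L M (h l))"
      unfolding has_bochner_integral_iff
      using I by (simp add: product_integrable_prod product_integral_prod)
    then show ?thesis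
      by (simp only: prod int)
  qed
  have "has_bochner_integral (Pi\<^sub>M I (\<lambda>_. M)) (\<lambda>w. \<Sum>i\<in>I. \<Sum>j\<in>I. g (w i) * g (w j))
      (\<Sum>i\<in>I. \<Sum>j\<in>I. if i = j then v else 0)"
    by (intro has_bochner_integral_sum cross)
  then show ?thesis
    using I by (simp add: power2_eq_square sum_product)
qed

text \<open>Centering \<open>f\<close> turns its second moment into the variance; the factor
  \<open>m\<close> from the sum against \<open>1 / m\<^sup>2\<close> from averaging leaves
  \<open>1 / m\<close>.\<close>

lemma has_bochner_integral_empirical_mean_PiM:
  fixes f :: "'a \<Rightarrow> real"
  assumes M: "prob_space M" and m: "0 < m"
    and f: "has_bochner_integral M f \<mu>" and f2: "has_bochner_integral M (\<lambda>x. (f x)\<^sup>2) s"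
  shows "has_bochner_integral (Pi\<^sub>M {..<m} (\<lambda>_. M)) (\<lambda>w. ((\<Sum>i<m. f (w i)) / real m - \<mu>)\<^sup>2)
    ((s - \<mu>\<^sup>2) / real m)"
proof -
  interpret prob_space M by fact
  define g where "g x = f x - \<mu>" for x
  have const: "has_bochner_integral M (\<lambda>_. c) c" for c :: real
    using prob_space by (simp add: has_bochner_integral_iff)
  have "has_bochner_integral M g (\<mu> - \<mu>)"
    unfolding g_def by (intro has_bochner_integral_diff f const)
  then have g: "has_bochner_integral M g 0" by simp
  have "has_bochner_integral M (\<lambda>x. (f x)\<^sup>2 - 2 * \<mu> * f x + \<mu>\<^sup>2) (s - 2 * \<mu> * \<mu> + \<mu>\<^sup>2)"
    by (intro has_bochner_integral_add has_bochner_integral_diff has_bochner_integral_mult_right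
        f f2 const)
  then have g2: "has_bochner_integral M (\<lambda>x. (g x)\<^sup>2) (s - \<mu>\<^sup>2)"
    by (simp add: g_def power2_eq_square algebra_simps)
  have "(\<Sum>i<m. f (w i)) / real m - \<mu> = (\<Sum>i<m. g (w i)) / real m" for w
    using m by (simp add: g_def sum_subtractf diff_divide_distrib)
  then have "((\<Sum>i<m. f (w i)) / real m - \<mu>)\<^sup>2 = 1 / (real m)\<^sup>2 * (\<Sum>i<m. g (w i))\<^sup>2" for w
    by (simp add: power_divide)
  moreover have "has_bochner_integral (Pi\<^sub>M {..<m} (\<lambda>_. M))
      (\<lambda>w. 1 / (real m)\<^sup>2 * (\<Sum>i<m. g (w i))\<^sup>2)
      (1 / (real m)\<^sup>2 * (real (card {..<m}) * (s - \<mu>\<^sup>2)))"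
    by (intro has_bochner_integral_mult_right has_bochner_integral_sum_squared_PiM M g g2) auto
  ultimately show ?thesis
    using m by (simp add: power2_eq_square)
qed

section \<open>Perturbation of normalised weights\<close>

lemma normalize_perturbation_le:
  fixes a b :: "'a \<Rightarrow> real"
  assumes b: "\<And>j. j \<in> J \<Longrightarrow> 0 \<le> b j" and a: "0 < sum a J" and b': "0 < sum b J"
  shows "(\<Sum>j\<in>J. \<bar>a j / sum a J - b j / sum b J\<bar>) \<le> 2 * (\<Sum>j\<in>J. \<bar>a j - b j\<bar>) / sum a J"
proof -
  have "\<bar>a j / sum a J - b j / sum b J\<bar>
      \<le> \<bar>a j - b j\<bar> / sum a J + b j / sum b J * (\<bar>sum a J - sum b J\<bar> / sum a J)"
    if "j \<in> J" for j
  proof -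
    \<comment> \<open>The split is chosen so that \<open>sum b J\<close> enters only through the
      weights \<open>b j / sum b J\<close>, which sum to 1. The final bound thus divides by
      \<open>sum a J\<close> alone, and no quantitative lower bound on the random normaliser is
      called for.\<close>
    have "a j / sum a J - b j / sum b J
        = (a j - b j) / sum a J + b j / sum b J * ((sum b J - sum a J) / sum a J)"
      using a b' by (simp add: field_simps)
    also have "\<bar>\<dots>\<bar> \<le> \<bar>(a j - b j) / sum a J\<bar> + \<bar>b j / sum b J * ((sum b J - sum a J) / sum a J)\<bar>"
      by (rule abs_triangle_ineq)
    finally show ?thesis
      using a b' b[OF that] by (simp add: abs_mult abs_minus_commute)
  qed
  then have "(\<Sum>j\<in>J. \<bar>a j / sum a J - b j / sum b J\<bar>)
      \<le> (\<Sum>j\<in>J. \<bar>a j - b j\<bar> / sum a J + b j / sum b J * (\<bar>sum a J - sum b J\<bar> / sum a J))"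
    by (rule sum_mono)
  also have "\<dots> = (\<Sum>j\<in>J. \<bar>a j - b j\<bar>) / sum a J + \<bar>sum a J - sum b J\<bar> / sum a J"
    using b' by (simp add: sum.distrib flip: sum_divide_distrib sum_distrib_right)
  also have "\<bar>sum a J - sum b J\<bar> \<le> (\<Sum>j\<in>J. \<bar>a j - b j\<bar>)"
    by (simp flip: sum_subtractf)
  finally show ?thesis
    using a by (simp add: divide_right_mono)
qed

text \<open>Jensen's inequality for the square, obtained from the nonnegativity of the variance of
  \<open>x\<close> under the weights \<open>p\<close>.\<close>

lemma weighted_mean_squared_le:
  fixes p x :: "'a \<Rightarrow> real"
  assumes p: "\<And>j. j \<in> J \<Longrightarrow> 0 \<le> p j" and sum: "sum p J = 1"
  shows "(\<Sum>j\<in>J. p j * x j)\<^sup>2 \<le> (\<Sum>j\<in>J. p j * (x j)\<^sup>2)"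
proof -
  let ?c = "\<Sum>j\<in>J. p j * x j"
  have "0 \<le> (\<Sum>j\<in>J. p j * (x j - ?c)\<^sup>2)"
    using p by (intro sum_nonneg) auto
  also have "\<dots> = (\<Sum>j\<in>J. p j * (x j)\<^sup>2 - 2 * ?c * (p j * x j) + ?c\<^sup>2 * p j)"
    by (intro sum.cong) (auto simp: power2_eq_square algebra_simps)
  also have "\<dots> = (\<Sum>j\<in>J. p j * (x j)\<^sup>2) - 2 * ?c * ?c + ?c\<^sup>2 * sum p J"
    by (simp only: sum.distrib sum_subtractf sum_distrib_left)
  finally show ?thesis
    by (simp add: sum power2_eq_square)
qed

section \<open>Positive random features\<close>

lemma L2_set_squared_eq_dot: "(L2_set x {..<d})\<^sup>2 = dot d x x"
  by (simp add: L2_set_def dot_def sum_nonneg power2_eq_square)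

lemma dot_add_self:
  "dot d (\<lambda>i. x i + y i) (\<lambda>i. x i + y i) = dot d x x + dot d y y + 2 * dot d x y"
  by (simp add: dot_def algebra_simps sum.distrib sum_distrib_left)

text \<open>The source of the exponent in \<open>exp (4 * R\<^sup>2)\<close>: by the triangle
  inequality the sum has norm at most \<open>2 * R\<close>.\<close>

lemma dot_add_self_le:
  assumes "L2_set x {..<d} \<le> R" "L2_set y {..<d} \<le> R"
  shows "dot d (\<lambda>i. x i + y i) (\<lambda>i. x i + y i) \<le> 4 * R\<^sup>2"
proof -
  have "L2_set (\<lambda>i. x i + y i) {..<d} \<le> 2 * R"
    using L2_set_triangle_ineq[of x y "{..<d}"] assms by linarith
  then have "(L2_set (\<lambda>i. x i + y i) {..<d})\<^sup>2 \<le> (2 * R)\<^sup>2"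
    by (intro power_mono) (auto simp: L2_set_nonneg)
  then show ?thesis
    by (simp add: L2_set_squared_eq_dot power_mult_distrib)
qed

definition mean_tilt :: "nat \<Rightarrow> nat \<Rightarrow> (nat \<Rightarrow> real) \<Rightarrow> (nat \<Rightarrow> nat \<Rightarrow> real) \<Rightarrow> real" where
  "mean_tilt m d y w = (\<Sum>i<m. gaussian_tilt d y (w i)) / real m"

lemma mean_tilt_pos: "0 < m \<Longrightarrow> 0 < mean_tilt m d y w"
  by (auto simp: mean_tilt_def gaussian_tilt_def intro!: divide_pos_pos sum_pos)

lemma has_bochner_integral_mean_tilt:
  assumes "0 < m"
  shows "has_bochner_integral (gaussian_rows m d) (\<lambda>w. (mean_tilt m d y w - 1)\<^sup>2)
    ((exp (dot d y y) - 1) / real m)"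
  using has_bochner_integral_empirical_mean_PiM[OF prob_space_std_gaussian assms
      has_bochner_integral_gaussian_tilt has_bochner_integral_gaussian_tilt_squared]
  by (simp add: gaussian_rows_def mean_tilt_def)

text \<open>Polarisation trades the two factors \<open>exp (- dot d x x / 2)\<close> and
  \<open>exp (- dot d y y / 2)\<close> for \<open>exp (dot d x y)\<close> and the normalisation of
  the tilt at \<open>x + y\<close>; the two factors \<open>1 / sqrt m\<close> combine to
  \<open>1 / m\<close>. At \<open>m = 0\<close> both sides are 0.\<close>

lemma dot_prf_map:
  "dot m (prf_map m d w x) (prf_map m d w y)
    = exp (dot d x y) * mean_tilt m d (\<lambda>i. x i + y i) w"
proof -
  have "exp (- dot d x x / 2) / sqrt (real m) * exp (dot d v x) *
      (exp (- dot d y y / 2) / sqrt (real m) * exp (dot d v y))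
      = exp (dot d x y) * (gaussian_tilt d (\<lambda>i. x i + y i) v / real m)" for v
  proof -
    have "dot d v (\<lambda>i. x i + y i) = dot d v x + dot d v y"
      by (simp add: dot_def algebra_simps sum.distrib)
    then have "exp (dot d x y) * gaussian_tilt d (\<lambda>i. x i + y i) v
        = exp (- dot d x x / 2) * exp (dot d v x) * (exp (- dot d y y / 2) * exp (dot d v y))"
      by (simp add: gaussian_tilt_def mult_exp_exp dot_add_self field_simps)
    then show ?thesis
      by simp
  qed
  then show ?thesis
    unfolding dot_def[of m] prf_map_def mean_tilt_def L2_set_squared_eq_dot
    by (simp only: sum_distrib_left sum_divide_distrib)
qed

text \<open>A pointwise bound, valid for every sample \<open>w\<close>. Since the estimated kernel
  is \<open>a j * t j\<close>, its absolute error is \<open>a j\<close> times the relative error,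
  and dividing by \<open>sum a {..<n}\<close> produces softmax weights, to which Jensen
  applies.\<close>

lemma attention_error_squared_le:
  assumes m: "0 < m" and n: "0 < n"
  shows "(l1_norm n (\<lambda>j. softmax_attention n d q k j - feature_attention n m (prf_map m d w) q k j))\<^sup>2
    \<le> 4 * (\<Sum>j<n. softmax_attention n d q k j * (mean_tilt m d (\<lambda>i. q i + k j i) w - 1)\<^sup>2)"
    (is "?E\<^sup>2 \<le> 4 * ?V")
proof -
  define a where "a j = exp (dot d q (k j))" for j
  define t where "t j = mean_tilt m d (\<lambda>i. q i + k j i) w" for j
  define b where "b j = a j * t j" for j
  \<comment> \<open>Positivity of the features keeps the random normaliser positive for every
    sample, so no exceptional event has to be excluded.\<close>
  have S: "0 < sum a {..<n}" and S': "0 < sum b {..<n}"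
    using n m by (auto intro!: sum_pos simp: a_def b_def t_def mean_tilt_pos lessThan_empty_iff)
  have b: "0 \<le> b j" for j
    using m by (simp add: b_def a_def t_def mean_tilt_pos less_imp_le)
  have soft: "softmax_attention n d q k j = a j / sum a {..<n}" for j
    by (simp add: softmax_attention_def a_def)
  have ab: "\<bar>a j - b j\<bar> = a j * \<bar>t j - 1\<bar>" for j
  proof -
    have "a j - b j = a j * (1 - t j)" by (simp add: b_def algebra_simps)
    then show ?thesis by (simp add: abs_mult a_def abs_minus_commute)
  qed
  have "?E = (\<Sum>j<n. \<bar>a j / sum a {..<n} - b j / sum b {..<n}\<bar>)"
    by (simp add: l1_norm_def soft feature_attention_def dot_prf_map b_def t_def flip: a_def)
  also have "\<dots> \<le> 2 * (\<Sum>j<n. \<bar>a j - b j\<bar>) / sum a {..<n}"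
    by (intro normalize_perturbation_le S S' b)
  finally have "?E \<le> 2 * (\<Sum>j<n. a j / sum a {..<n} * \<bar>t j - 1\<bar>)"
    by (simp add: ab sum_divide_distrib flip: times_divide_eq_right)
  then have "?E\<^sup>2 \<le> (2 * (\<Sum>j<n. a j / sum a {..<n} * \<bar>t j - 1\<bar>))\<^sup>2"
    by (intro power_mono) (auto simp: l1_norm_def intro: sum_nonneg)
  also have "\<dots> = 4 * (\<Sum>j<n. a j / sum a {..<n} * \<bar>t j - 1\<bar>)\<^sup>2"
    by (simp add: power_mult_distrib)
  also have "(\<Sum>j<n. a j / sum a {..<n} * \<bar>t j - 1\<bar>)\<^sup>2 \<le> (\<Sum>j<n. a j / sum a {..<n} * \<bar>t j - 1\<bar>\<^sup>2)"
    using S by (intro weighted_mean_squared_le)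
      (auto simp: a_def simp flip: sum_divide_distrib intro!: divide_nonneg_pos)
  finally show ?thesis
    by (simp add: soft t_def)
qed

text \<open>Markov's inequality is applied to the softmax-weighted average \<open>?V\<close> of the
  squared relative errors. Its weights sum to 1, so its expectation inherits the bound
  \<open>exp (4 * R\<^sup>2) / m\<close> of a single key, without a union bound over the
  keys.\<close>

lemma attention_error_tail:
  assumes n: "0 < n" and m: "0 < m" and \<epsilon>: "0 < \<epsilon>"
    and q: "L2_set q {..<d} \<le> R" and k: "\<And>j. j < n \<Longrightarrow> L2_set (k j) {..<d} \<le> R"
  shows "\<P>(w in gaussian_rows m d.
      \<epsilon> \<le> l1_norm n (\<lambda>j. softmax_attention n d q k j
                       - feature_attention n m (prf_map m d w) q k j))
    \<le> 4 * exp (4 * R\<^sup>2) / (real m * \<epsilon>\<^sup>2)"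
proof -
  let ?G = "gaussian_rows m d"
  let ?p = "softmax_attention n d q k"
  let ?y = "\<lambda>j i. q i + k j i"
  let ?V = "\<lambda>w. \<Sum>j<n. ?p j * (mean_tilt m d (?y j) w - 1)\<^sup>2"
  interpret prob_space ?G by (rule prob_space_gaussian_rows)
  have V: "has_bochner_integral ?G ?V (\<Sum>j<n. ?p j * ((exp (dot d (?y j) (?y j)) - 1) / real m))"
    by (intro has_bochner_integral_sum has_bochner_integral_mult_right has_bochner_integral_mean_tilt m)
  have p: "0 \<le> ?p j" for j
    by (simp add: softmax_attention_def sum_nonneg)
  have "(\<Sum>j<n. exp (dot d q (k j))) > 0"
    using n by (intro sum_pos) (auto simp: lessThan_empty_iff)
  then have p1: "sum ?p {..<n} = 1"
    by (simp add: softmax_attention_def flip: sum_divide_distrib)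
  have V_nonneg: "0 \<le> ?V w" for w
    using p by (intro sum_nonneg) auto
  have "integral\<^sup>L ?G ?V = (\<Sum>j<n. ?p j * ((exp (dot d (?y j) (?y j)) - 1) / real m))"
    using V by (rule has_bochner_integral_integral_eq)
  also have "\<dots> \<le> (\<Sum>j<n. ?p j * (exp (4 * R\<^sup>2) / real m))"
  proof (intro sum_mono mult_left_mono divide_right_mono p)
    fix j assume "j \<in> {..<n}"
    then have "exp (dot d (?y j) (?y j)) \<le> exp (4 * R\<^sup>2)"
      using dot_add_self_le[OF q k] by simp
    then show "exp (dot d (?y j) (?y j)) - 1 \<le> exp (4 * R\<^sup>2)"
      by linarith
  qed simp
  also have "\<dots> = exp (4 * R\<^sup>2) / real m"
    by (simp only: p1 mult_1 flip: sum_distrib_right)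
  finally have EV: "integral\<^sup>L ?G ?V \<le> exp (4 * R\<^sup>2) / real m" .
  have int: "integrable ?G ?V"
    using V by (simp add: has_bochner_integral_iff)
  then have [measurable]: "?V \<in> borel_measurable ?G"
    by (rule borel_measurable_integrable)
  \<comment> \<open>Monotonicity asks for measurability of the larger event, which that of
    \<open>?V\<close> supplies. The threshold \<open>\<epsilon>\<^sup>2 / 4\<close> undoes the
    factor 4 of the pointwise bound.\<close>
  have "prob {w \<in> space ?G. \<epsilon> \<le> l1_norm n (\<lambda>j. ?p j - feature_attention n m (prf_map m d w) q k j)}
      \<le> prob {w \<in> space ?G. \<epsilon>\<^sup>2 / 4 \<le> ?V w}"
  proof (rule finite_measure_mono)
    show "{w \<in> space ?G. \<epsilon> \<le> l1_norm n (\<lambda>j. ?p j - feature_attention n m (prf_map m d w) q k j)}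
        \<subseteq> {w \<in> space ?G. \<epsilon>\<^sup>2 / 4 \<le> ?V w}"
    proof safe
      fix w
      assume "\<epsilon> \<le> l1_norm n (\<lambda>j. ?p j - feature_attention n m (prf_map m d w) q k j)"
      then have "\<epsilon>\<^sup>2 \<le> (l1_norm n (\<lambda>j. ?p j - feature_attention n m (prf_map m d w) q k j))\<^sup>2"
        using \<epsilon> by (intro power_mono) auto
      also have "\<dots> \<le> 4 * ?V w"
        by (rule attention_error_squared_le[OF m n])
      finally show "\<epsilon>\<^sup>2 / 4 \<le> ?V w"
        by simp
    qed
  qed measurable
  also have "\<dots> \<le> integral\<^sup>L ?G ?V / (\<epsilon>\<^sup>2 / 4)"
    using \<epsilon> V_nonneg by (intro integral_Markov_inequality_measure[OF int, where A = "{}"]) auto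
  also have "\<dots> \<le> exp (4 * R\<^sup>2) / real m / (\<epsilon>\<^sup>2 / 4)"
    using EV by (intro divide_right_mono) auto
  finally show ?thesis
    by (simp add: mult_ac)
qed

theorem theorem3:
  "\<exists>C>0::real. \<forall>(n::nat) (d::nat) (R::real) (q::nat \<Rightarrow> real) (k::nat \<Rightarrow> nat \<Rightarrow> real)
      (\<epsilon>::real) (\<delta>::real) (m::nat).
    1 \<le> n \<longrightarrow> 1 \<le> d \<longrightarrow> 0 < R \<longrightarrow>
    L2_set q {..<d} \<le> R \<longrightarrow> (\<forall>j<n. L2_set (k j) {..<d} \<le> R) \<longrightarrow>
    0 < \<epsilon> \<longrightarrow> 0 < \<delta> \<longrightarrow> \<delta> < 1 \<longrightarrow>
    m = nat \<lceil>C * (real n * exp (4 * R\<^sup>2) / (\<epsilon>\<^sup>2 * \<delta>))\<rceil> \<longrightarrow>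
    \<P>(w in gaussian_rows m d.
        \<epsilon> \<le> l1_norm n (\<lambda>j. softmax_attention n d q k j
                         - feature_attention n m (prf_map m d w) q k j)) \<le> \<delta>"
\<comment> \<open>The witness 4 is the square of the factor 2 lost in normalisation.\<close>
proof (intro exI[of _ 4] conjI allI impI)
  fix n d m :: nat and R \<epsilon> \<delta> :: real and q :: "nat \<Rightarrow> real" and k :: "nat \<Rightarrow> nat \<Rightarrow> real"
  assume n: "1 \<le> n" and q: "L2_set q {..<d} \<le> R" and k: "\<forall>j<n. L2_set (k j) {..<d} \<le> R"
    and \<epsilon>: "0 < \<epsilon>" and \<delta>: "0 < \<delta>"
    and m: "m = nat \<lceil>4 * (real n * exp (4 * R\<^sup>2) / (\<epsilon>\<^sup>2 * \<delta>))\<rceil>"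
  have "0 < 4 * (real n * exp (4 * R\<^sup>2) / (\<epsilon>\<^sup>2 * \<delta>))"
    using n \<epsilon> \<delta> by simp
  moreover have m_ge: "4 * (real n * exp (4 * R\<^sup>2) / (\<epsilon>\<^sup>2 * \<delta>)) \<le> real m"
    unfolding m by (rule real_nat_ceiling_ge)
  ultimately have m_pos: "0 < m"
    by linarith
  \<comment> \<open>Because \<open>1 \<le> n\<close>, the choice of \<open>m\<close> makes the tail
    bound at most \<open>\<delta>\<close>.\<close>
  have "1 * (4 * exp (4 * R\<^sup>2)) \<le> real n * (4 * exp (4 * R\<^sup>2))"
    using n by (intro mult_right_mono) auto
  also have "\<dots> \<le> \<delta> * (real m * \<epsilon>\<^sup>2)"
    using m_ge \<epsilon> \<delta> by (simp add: field_simps)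
  finally have "4 * exp (4 * R\<^sup>2) / (real m * \<epsilon>\<^sup>2) \<le> \<delta>"
    using m_pos \<epsilon> by (simp add: pos_divide_le_eq)
  moreover have "\<P>(w in gaussian_rows m d.
        \<epsilon> \<le> l1_norm n (\<lambda>j. softmax_attention n d q k j
                         - feature_attention n m (prf_map m d w) q k j))
      \<le> 4 * exp (4 * R\<^sup>2) / (real m * \<epsilon>\<^sup>2)"
    using n m_pos \<epsilon> q k by (intro attention_error_tail) auto
  ultimately show "\<P>(w in gaussian_rows m d.
        \<epsilon> \<le> l1_norm n (\<lambda>j. softmax_attention n d q k j
                         - feature_attention n m (prf_map m d w) q k j)) \<le> \<delta>"
    by linarith
qed simp

end
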